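(* Let $R_N$ be the ring (cycle) graph with $N$ vertices indexed modulo $N$ and $N$ edges, edge $i$ going from $i$ to $i+1$ and carrying nonzero real weight $\gamma_i$, $i=1,\dots,N$. Suppose $\gamma_1<0$ and $\gamma_i>0$ for $i=2,\dots,N$. Then the condition for the Laplacian matrix of this weighted ring to be stable is $\sum_{i=1}^N\gamma_i^{-1}<0$; that is, it is stable if and only if $$\gamma_1>\frac{-1}{\displaystyle\sum_{i=2}^{N}\frac{1}{\gamma_i}} .$$ If all the positive edges have equal weight, $\gamma_i=\gamma$ for $i=2,\dots,N$, this condition becomes $\gamma_1>-\gamma/(N-1)$.
   Context: The Laplacian matrix of a simple undirected graph with real edge weights $\gamma$ is the symmetric matrix with off-diagonal entries $\mathcal{L}_{v,w}=\gamma_{(v,w)}$ ($=0$ if $v,w$ are not adjacent) and diagonal entries $\mathcal{L}_{v,v}=-\sum_u\gamma_{(v,u)}$ (the negative of the usual sign convention). The Laplacian is stable if it has no positive eigenvalues.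
   Formalization: The equivalence with stability is proved except when the sum of all 1/γ_i is 0 (equality in the condition), where the Laplacian is stable although the strict inequality fails; with stability plus a simple eigenvalue 0 it is proved without exception. *)

theory Defs
  imports Complex_Main
    "Jordan_Normal_Form.Char_Poly"
    "Jordan_Normal_Form.Matrix_Kernel"
begin

(* A weighted simple graph on the vertices 0, ..., n-1 is given by a symmetric function w with zero
   diagonal; w u v is the weight of the edge joining u and v, and 0 if they are not adjacent.
   The sign is opposite to the usual one. *)
definition graph_laplacian :: "nat \<Rightarrow> (nat \<Rightarrow> nat \<Rightarrow> real) \<Rightarrow> real mat" where
  "graph_laplacian n w =
     mat n n (\<lambda>(v, u). if v = u then - (\<Sum>u'<n. w v u') else w v u)"

(* The vertices are the residues 0, ..., N-1 modulo N, so vertex N is the vertex 0.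
   For N >= 3 at most one edge index i contributes to the sum. *)
definition ring_weight :: "nat \<Rightarrow> (nat \<Rightarrow> real) \<Rightarrow> nat \<Rightarrow> nat \<Rightarrow> real" where
  "ring_weight N \<gamma> u v =
     (\<Sum>i | i \<in> {1..N} \<and> {u, v} = {i mod N, (i + 1) mod N}. \<gamma> i)"

definition ring_laplacian :: "nat \<Rightarrow> (nat \<Rightarrow> real) \<Rightarrow> real mat" where
  "ring_laplacian N \<gamma> = graph_laplacian N (ring_weight N \<gamma>)"

(* Meant for symmetric matrices, whose eigenvalues are all real. *)
definition stable_mat :: "real mat \<Rightarrow> bool" where
  "stable_mat A \<longleftrightarrow> \<not> (\<exists>k. eigenvalue A k \<and> k > 0)"

(* The all-ones vector lies in the kernel of every Laplacian. In the strict notion 0 has no further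
   multiplicity; for symmetric matrices the dimension of the kernel is that multiplicity. *)
definition strictly_stable_mat :: "real mat \<Rightarrow> bool" where
  "strictly_stable_mat A \<longleftrightarrow> stable_mat A \<and> kernel_dim A = 1"

end

(* Write d i for the difference of x across edge i; then x . L x = - (SUM i. gamma i * (d i)^2), and
   the d i sum to 0 around the ring. By Cauchy-Schwarz, (d 1)^2 is at most
   (SUM i=2..N. 1 / gamma i) * (SUM i=2..N. gamma i * (d i)^2), with equality for the potential with
   unit flow along the positive edges. So the sign of SUM i. 1 / gamma i decides whether the form is
   negative semidefinite, and at 0 that potential is a second kernel vector besides the constants.
   A symmetric matrix whose form takes a positive value has a positive eigenvalue. *)

theory Submission
  imports Defs
begin

section \<open>Quadratic forms of symmetric matrices\<close>

lemma mat_vec_bilinear_eq_sum: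
  fixes A :: "'a :: comm_semiring_0 mat"
  assumes "A \<in> carrier_mat n n" "x \<in> carrier_vec n" "y \<in> carrier_vec n"
  shows "y \<bullet> (A *\<^sub>v x) = (\<Sum>i<n. \<Sum>j<n. y $ i * (A $$ (i, j) * x $ j))"
  using assms by (auto simp: scalar_prod_def sum_distrib_left atLeast0LessThan intro!: sum.cong)

lemma square_index_le_scalar_prod:
  fixes x :: "real vec"
  assumes "x \<in> carrier_vec n" "i < n"
  shows "(x $ i)\<^sup>2 \<le> x \<bullet> x"
proof -
  have "(x $ i)\<^sup>2 \<le> (\<Sum>j<n. (x $ j)\<^sup>2)"
    by (rule member_le_sum) (use assms in auto)
  also have "\<dots> = x \<bullet> x"
    using assms by (auto simp: scalar_prod_def power2_eq_square atLeast0LessThan)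
  finally show ?thesis .
qed

lemma scalar_prod_self_nonneg:
  fixes x :: "real vec"
  shows "0 \<le> x \<bullet> x"
  by (auto simp: scalar_prod_def intro!: sum_nonneg)

lemma scalar_prod_self_pos:
  fixes x :: "real vec"
  assumes "x \<in> carrier_vec n" "x \<noteq> 0\<^sub>v n"
  shows "0 < x \<bullet> x"
proof -
  from assms obtain i where i: "i < n" "x $ i \<noteq> 0"
    by (metis carrier_vecD eq_vecI index_zero_vec)
  then have "0 < (x $ i)\<^sup>2" by simp
  with square_index_le_scalar_prod[OF assms(1) i(1)] show ?thesis by linarith
qed

lemma quadratic_form_bounded:
  fixes A :: "real mat"
  assumes A: "A \<in> carrier_mat n n"
  obtains K where "0 < K" "\<And>x. x \<in> carrier_vec n \<Longrightarrow> \<bar>x \<bullet> (A *\<^sub>v x)\<bar> \<le> K * (x \<bullet> x)"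
proof
  let ?K = "\<Sum>i<n. \<Sum>j<n. \<bar>A $$ (i, j)\<bar>"
  \<comment> \<open>The added 1 keeps the constant strictly positive even for the zero
    matrix.\<close>
  show "0 < ?K + 1" by (intro add_nonneg_pos sum_nonneg) auto
  fix x :: "real vec" assume x: "x \<in> carrier_vec n"
  have "\<bar>x $ i * (A $$ (i, j) * x $ j)\<bar> \<le> \<bar>A $$ (i, j)\<bar> * (x \<bullet> x)" if "i < n" "j < n" for i j
  proof -
    have "0 \<le> (\<bar>x $ i\<bar> - \<bar>x $ j\<bar>)\<^sup>2" by simp
    then have "2 * (\<bar>x $ i\<bar> * \<bar>x $ j\<bar>) \<le> (x $ i)\<^sup>2 + (x $ j)\<^sup>2"
      by (simp add: power2_diff)
    then have "\<bar>x $ i\<bar> * \<bar>x $ j\<bar> \<le> x \<bullet> x"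
      using square_index_le_scalar_prod[OF x that(1)] square_index_le_scalar_prod[OF x that(2)]
      by linarith
    then have "\<bar>A $$ (i, j)\<bar> * (\<bar>x $ i\<bar> * \<bar>x $ j\<bar>) \<le> \<bar>A $$ (i, j)\<bar> * (x \<bullet> x)"
      by (intro mult_left_mono) auto
    then show ?thesis by (simp add: abs_mult mult_ac)
  qed
  then have "\<bar>x \<bullet> (A *\<^sub>v x)\<bar> \<le> (\<Sum>i<n. \<Sum>j<n. \<bar>A $$ (i, j)\<bar> * (x \<bullet> x))"
    unfolding mat_vec_bilinear_eq_sum[OF A x x]
    by (intro order.trans[OF sum_abs] sum_mono) auto
  also have "\<dots> = ?K * (x \<bullet> x)" by (simp add: sum_distrib_right)
  also have "\<dots> \<le> (?K + 1) * (x \<bullet> x)"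
    using scalar_prod_self_nonneg[of x] by (simp add: distrib_right)
  finally show "\<bar>x \<bullet> (A *\<^sub>v x)\<bar> \<le> (?K + 1) * (x \<bullet> x)" .
qed

text \<open>For \<open>c < 0\<close> the polynomial in \<open>t\<close> has its maximum
  \<open>a - b^2 / c\<close> at \<open>t = - b / c\<close>. Both Cauchy-Schwarz inequalities below
  are instances.\<close>

lemma nonpos_quadratic_discriminant:
  fixes a b c :: real
  assumes "c \<le> 0" and nonpos: "\<And>t. a + 2 * t * b + t\<^sup>2 * c \<le> 0"
  shows "b\<^sup>2 \<le> a * c"
proof (cases "c = 0")
  case True
  \<comment> \<open>With \<open>c = 0\<close> and \<open>b\<close> nonzero the polynomial is linear,
    and this \<open>t\<close> gives it the value 1.\<close>
  then have "b = 0" using nonpos[of "(1 - a) / (2 * b)"] by (cases "b = 0") (simp_all add: field_simps)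
  then show ?thesis using True by simp
next
  case False
  with assms(1) have "c < 0" by simp
  moreover have "a - b\<^sup>2 / c \<le> 0"
    using nonpos[of "- b / c"] False by (simp add: power2_eq_square)
  ultimately show ?thesis by (simp add: field_simps)
qed

text \<open>The form at \<open>u + t \<cdot>\<^sub>v v\<close> is a nonpositive polynomial in
  \<open>t\<close>; symmetry merges its two mixed terms into \<open>2 * t * b\<close>.\<close>

lemma symmetric_negative_semidefinite_Cauchy_Schwarz:
  fixes B :: "real mat"
  assumes B: "B \<in> carrier_mat n n" and sym: "transpose_mat B = B"
    and nonpos: "\<And>x. x \<in> carrier_vec n \<Longrightarrow> x \<bullet> (B *\<^sub>v x) \<le> 0"
    and u: "u \<in> carrier_vec n" and v: "v \<in> carrier_vec n"
  shows "(u \<bullet> (B *\<^sub>v v))\<^sup>2 \<le> (u \<bullet> (B *\<^sub>v u)) * (v \<bullet> (B *\<^sub>v v))"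
proof (rule nonpos_quadratic_discriminant[OF nonpos[OF v]])
  fix t :: real
  have Bu: "B *\<^sub>v u \<in> carrier_vec n" and Bv: "B *\<^sub>v v \<in> carrier_vec n"
    using B u v by auto
  have vu: "v \<bullet> (B *\<^sub>v u) = u \<bullet> (B *\<^sub>v v)"
    using transpose_vec_mult_scalar[OF B u v] sym Bv comm_scalar_prod[OF u Bv] by simp
  have "(u + t \<cdot>\<^sub>v v) \<bullet> (B *\<^sub>v (u + t \<cdot>\<^sub>v v)) = (u + t \<cdot>\<^sub>v v) \<bullet> (B *\<^sub>v u + t \<cdot>\<^sub>v (B *\<^sub>v v))"
    using B u v by (simp add: mult_add_distrib_mat_vec[OF B] mult_mat_vec[OF B])
  also have "\<dots> = u \<bullet> (B *\<^sub>v u) + 2 * t * (u \<bullet> (B *\<^sub>v v)) + t\<^sup>2 * (v \<bullet> (B *\<^sub>v v))"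
    using u v Bu Bv vu
    by (simp add: add_scalar_prod_distrib[of _ n] scalar_prod_add_distrib[of _ n]
        power2_eq_square algebra_simps)
  finally show "u \<bullet> (B *\<^sub>v u) + 2 * t * (u \<bullet> (B *\<^sub>v v)) + t\<^sup>2 * (v \<bullet> (B *\<^sub>v v)) \<le> 0"
    using nonpos[of "u + t \<cdot>\<^sub>v v"] u v by simp
qed

text \<open>An invertible semidefinite form stays away from 0 on the unit sphere. Cauchy-Schwarz is
  applied to \<open>x\<close> and its preimage \<open>u\<close> under \<open>B\<close>: the mixed
  term is \<open>x \<bullet> x\<close>, while \<open>u \<bullet> x\<close> is a bounded form in
  \<open>x\<close>, so one factor \<open>x \<bullet> x\<close> cancels.\<close>

lemma symmetric_negative_semidefinite_invertible_gap:
  fixes B :: "real mat"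
  assumes B: "B \<in> carrier_mat n n" and sym: "transpose_mat B = B"
    and nonpos: "\<And>x. x \<in> carrier_vec n \<Longrightarrow> x \<bullet> (B *\<^sub>v x) \<le> 0"
    and det: "det B \<noteq> 0"
  obtains K where "0 < K" "\<And>x. x \<in> carrier_vec n \<Longrightarrow> x \<bullet> x \<le> K * - (x \<bullet> (B *\<^sub>v x))"
proof -
  from det_non_zero_imp_unit[OF B det, unfolded Units_def, of "()"]
  obtain M where M: "M \<in> carrier_mat n n" and BM: "B * M = 1\<^sub>m n"
    by (auto simp: ring_mat_def)
  from quadratic_form_bounded[OF M] obtain K where K: "0 < K"
    "\<And>x. x \<in> carrier_vec n \<Longrightarrow> \<bar>x \<bullet> (M *\<^sub>v x)\<bar> \<le> K * (x \<bullet> x)" by blast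
  show ?thesis
  proof
    fix x :: "real vec" assume x: "x \<in> carrier_vec n"
    define u where "u = M *\<^sub>v x"
    have u: "u \<in> carrier_vec n" using M x by (simp add: u_def)
    have Bu: "B *\<^sub>v u = x"
      using assoc_mult_mat_vec[OF B M x] BM x by (simp add: u_def)
    have "u \<bullet> (B *\<^sub>v x) = x \<bullet> x"
      using transpose_vec_mult_scalar[OF B x u] sym Bu by simp
    then have "(x \<bullet> x)\<^sup>2 \<le> (u \<bullet> x) * (x \<bullet> (B *\<^sub>v x))"
      using symmetric_negative_semidefinite_Cauchy_Schwarz[OF B sym nonpos u x] Bu by simp
    also have "\<dots> = - (u \<bullet> x) * - (x \<bullet> (B *\<^sub>v x))" by simp
    also have "\<dots> \<le> (K * (x \<bullet> x)) * - (x \<bullet> (B *\<^sub>v x))"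
      using K(2)[OF x] nonpos[OF x] comm_scalar_prod[OF x u]
      by (intro mult_right_mono) (auto simp: u_def)
    finally have le: "(x \<bullet> x) * (x \<bullet> x) \<le> (x \<bullet> x) * (K * - (x \<bullet> (B *\<^sub>v x)))"
      by (simp add: power2_eq_square mult_ac)
    show "x \<bullet> x \<le> K * - (x \<bullet> (B *\<^sub>v x))"
    proof (cases "x \<bullet> x = 0")
      case True
      then show ?thesis using K(1) nonpos[OF x]
        by (simp add: mult_nonneg_nonpos)
    next
      case False
      then have "0 < x \<bullet> x" using scalar_prod_self_nonneg[of x] by linarith
      then show ?thesis by (rule mult_left_le_imp_le[OF le])
    qed
  qed fact
qed

text \<open>The least \<open>k \<ge> 0\<close> with \<open>x \<bullet> A x \<le> k (x \<bullet> x)\<close> for all \<open>x\<close> is an eigenvalue: if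
  \<open>A - k I\<close> were invertible, the gap above would allow a smaller \<open>k\<close>.\<close>

lemma symmetric_positive_eigenvalueI:
  fixes A :: "real mat"
  assumes A: "A \<in> carrier_mat n n" and sym: "transpose_mat A = A"
    and z: "z \<in> carrier_vec n" "0 < z \<bullet> (A *\<^sub>v z)"
  shows "\<exists>k. eigenvalue A k \<and> k > 0"
proof -
  define T where "T = {k. 0 \<le> k \<and> (\<forall>x\<in>carrier_vec n. x \<bullet> (A *\<^sub>v x) \<le> k * (x \<bullet> x))}"
  from quadratic_form_bounded[OF A] obtain K where K: "0 < K"
    "\<And>x. x \<in> carrier_vec n \<Longrightarrow> \<bar>x \<bullet> (A *\<^sub>v x)\<bar> \<le> K * (x \<bullet> x)" by blast
  then have "K \<in> T" by (force simp: T_def)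
  then have ne: "T \<noteq> {}" by auto
  have bdd: "bdd_below T" by (rule bdd_belowI[of _ 0]) (auto simp: T_def)
  define k where "k = Inf T"
  have k_ub: "x \<bullet> (A *\<^sub>v x) \<le> k * (x \<bullet> x)" if x: "x \<in> carrier_vec n" for x
  proof (cases "x \<bullet> x = 0")
    case True
    then show ?thesis using K(2)[OF x] by simp
  next
    case False
    then have pos: "0 < x \<bullet> x" using scalar_prod_self_nonneg[of x] by linarith
    \<comment> \<open>Every Rayleigh quotient is a lower bound of \<open>T\<close>, so the infimum
      still bounds the form.\<close>
    have "x \<bullet> (A *\<^sub>v x) / (x \<bullet> x) \<le> k"
      unfolding k_def using x pos by (intro cInf_greatest ne) (auto simp: T_def field_simps)
    then show ?thesis using pos by (simp add: field_simps)
  qed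
  have "0 < k * (z \<bullet> z)" using k_ub[OF z(1)] z(2) by linarith
  then have "0 < k" using scalar_prod_self_nonneg[of z] by (simp add: zero_less_mult_iff)
  moreover have "eigenvalue A k"
  proof (rule ccontr)
    assume not_ev: "\<not> eigenvalue A k"
    define B where "B = char_matrix A k"
    have B: "B \<in> carrier_mat n n" using A by (simp add: B_def)
    have det: "det B \<noteq> 0" using not_ev eigenvalue_det[OF A] by (simp add: B_def)
    have symB: "transpose_mat B = B"
    proof (rule eq_matI)
      have "A $$ (j, i) = A $$ (i, j)" if "i < n" "j < n" for i j
        using arg_cong[OF sym, of "\<lambda>M. M $$ (i, j)"] A that by simp
      then show "transpose_mat B $$ (i, j) = B $$ (i, j)" if "i < dim_row B" "j < dim_col B" for i j
        using A that by (simp add: B_def char_matrix_def)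
    qed (use B in auto)
    have form: "x \<bullet> (B *\<^sub>v x) = x \<bullet> (A *\<^sub>v x) - k * (x \<bullet> x)" if x: "x \<in> carrier_vec n" for x
    proof -
      have "B *\<^sub>v x = A *\<^sub>v x + (- k) \<cdot>\<^sub>v x"
        using A x by (intro eq_vecI)
          (auto simp: B_def char_matrix_def add_mult_distrib_mat_vec[of _ n n])
      then show ?thesis
        using A x by (simp add: scalar_prod_add_distrib[of _ n])
    qed
    have "x \<bullet> (B *\<^sub>v x) \<le> 0" if "x \<in> carrier_vec n" for x
      using form[OF that] k_ub[OF that] by simp
    from symmetric_negative_semidefinite_invertible_gap[OF B symB this det]
    obtain C where C: "0 < C" "\<And>x. x \<in> carrier_vec n \<Longrightarrow> x \<bullet> x \<le> C * - (x \<bullet> (B *\<^sub>v x))"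
      by blast
    \<comment> \<open>The gap allows lowering \<open>k\<close> by \<open>1 / C\<close>; the maximum
      with 0 keeps the new bound in \<open>T\<close>. As \<open>0 < k\<close>, it is smaller than
      \<open>k\<close> in either case.\<close>
    define k' where "k' = max 0 (k - 1 / C)"
    have "x \<bullet> (A *\<^sub>v x) \<le> k' * (x \<bullet> x)" if x: "x \<in> carrier_vec n" for x
    proof -
      have "x \<bullet> x / C \<le> - (x \<bullet> (B *\<^sub>v x))"
        using C(2)[OF x] C(1) by (simp add: field_simps)
      then have "x \<bullet> (A *\<^sub>v x) \<le> (k - 1 / C) * (x \<bullet> x)"
        using form[OF x] by (simp add: algebra_simps)
      also have "\<dots> \<le> k' * (x \<bullet> x)"
        using scalar_prod_self_nonneg[of x] by (intro mult_right_mono) (auto simp: k'_def)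
      finally show ?thesis .
    qed
    then have "k' \<in> T" by (auto simp: T_def k'_def)
    then have "k \<le> k'" unfolding k_def by (rule cInf_lower[OF _ bdd])
    then show False using \<open>0 < k\<close> C(1) by (auto simp: k'_def max_def split: if_splits)
  qed
  ultimately show ?thesis by blast
qed

section \<open>One-dimensional kernels\<close>

text \<open>Trades the abstract dimension for a concrete spanning vector, so that later arguments
  only compare entries of vectors.\<close>

lemma kernel_dim_eq_1_iff:
  fixes A :: "'a :: field mat"
  assumes A: "A \<in> carrier_mat nr nc"
  shows "kernel_dim A = 1 \<longleftrightarrow>
    (\<exists>v\<in>mat_kernel A. v \<noteq> 0\<^sub>v nc \<and> (\<forall>u\<in>mat_kernel A. \<exists>c. u = c \<cdot>\<^sub>v v))"
proof -
  interpret kernel nr nc A by (unfold_locales, rule A)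
  have lincomb1: "lincomb a {v} = a v \<cdot>\<^sub>v v" if v: "v \<in> mat_kernel A" for a v
  proof (rule eq_vecI)
    have vc: "v \<in> carrier_vec nc" using v mat_kernel_carrier[OF A] by auto
    have lc: "lincomb a {v} \<in> mat_kernel A"
      using v by (intro Ker.lincomb_closed) auto
    then have "lincomb a {v} \<in> carrier_vec nc" using mat_kernel_carrier[OF A] by auto
    then show "dim_vec (lincomb a {v}) = dim_vec (a v \<cdot>\<^sub>v v)" using vc by simp
    show "lincomb a {v} $ i = (a v \<cdot>\<^sub>v v) $ i" if "i < dim_vec (a v \<cdot>\<^sub>v v)" for i
      using lincomb_index[of i "{v}" a] v vc that by simp
  qed
  have gen: "gen_set {v} \<longleftrightarrow> (\<forall>u\<in>mat_kernel A. \<exists>c. u = c \<cdot>\<^sub>v v)" if v: "v \<in> mat_kernel A" for v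
  proof
    assume g: "gen_set {v}"
    show "\<forall>u\<in>mat_kernel A. \<exists>c. u = c \<cdot>\<^sub>v v"
    proof
      fix u assume "u \<in> mat_kernel A"
      then have "u \<in> span {v}" using g by simp
      then obtain a where "u = lincomb a {v}"
        using Ker.finite_span[of "{v}"] v by auto
      then show "\<exists>c. u = c \<cdot>\<^sub>v v" using lincomb1[OF v] by auto
    qed
  next
    assume r: "\<forall>u\<in>mat_kernel A. \<exists>c. u = c \<cdot>\<^sub>v v"
    have "u \<in> span {v}" if "u \<in> mat_kernel A" for u
    proof -
      from r that obtain c where "u = c \<cdot>\<^sub>v v" by blast
      then have "u = lincomb (\<lambda>_. c) {v}" using lincomb1[OF v] by simp
      then show ?thesis using Ker.finite_span[of "{v}"] v by auto
    qed
    moreover have "span {v} \<subseteq> mat_kernel A" using v by (intro Ker.span_is_subset2) auto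
    ultimately show "gen_set {v}" by (intro equalityI subsetI) auto
  qed
  show ?thesis
  proof
    assume "kernel_dim A = 1"
    then have dim: "dim = 1" by simp
    from kernel_basis_exists[OF A] obtain S where S: "finite S" "basis S" by blast
    then have "card S = 1" using Ker.dim_basis dim by simp
    then obtain v where Sv: "S = {v}" by (auto simp: card_1_singleton_iff)
    with S(2) have v: "v \<in> mat_kernel A" and g: "gen_set {v}" and li: "lin_indpt {v}"
      by (auto simp: Ker.basis_def)
    have "v \<noteq> 0\<^sub>v nc"
    proof
      assume "v = 0\<^sub>v nc"
      \<comment> \<open>Nontriviality of the field, under which an independent set cannot contain
        the zero vector.\<close>
      moreover have "(UNIV :: 'a set) \<noteq> {0}" by (metis UNIV_I singletonD zero_neq_one)
      ultimately show False using li Ker.zero_nin_lin_indpt[of "{v}"] v by auto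
    qed
    then show "\<exists>v\<in>mat_kernel A. v \<noteq> 0\<^sub>v nc \<and> (\<forall>u\<in>mat_kernel A. \<exists>c. u = c \<cdot>\<^sub>v v)"
      using v g gen[OF v] by blast
  next
    assume "\<exists>v\<in>mat_kernel A. v \<noteq> 0\<^sub>v nc \<and> (\<forall>u\<in>mat_kernel A. \<exists>c. u = c \<cdot>\<^sub>v v)"
    then obtain v where v: "v \<in> mat_kernel A" "v \<noteq> 0\<^sub>v nc"
      and "\<forall>u\<in>mat_kernel A. \<exists>c. u = c \<cdot>\<^sub>v v" by blast
    then have "gen_set {v}" using gen by blast
    then show "kernel_dim A = 1" using Ker.dim1I v by simp
  qed
qed

section \<open>The Laplacian of a ring\<close>

text \<open>\<open>x\<close> is a function, so vectors enter as \<open>($) x\<close>. Edge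
  \<open>N\<close> runs from vertex 0 to vertex 1, and edge 1 from vertex 1 to vertex 2.\<close>

abbreviation ring_diff :: "nat \<Rightarrow> (nat \<Rightarrow> real) \<Rightarrow> nat \<Rightarrow> real" where
  "ring_diff N x i \<equiv> x ((i + 1) mod N) - x (i mod N)"

text \<open>The diagonal entry is minus the row sum, so each row of the product is a weighted sum of
  differences \<open>x $ u - x $ v\<close>; \<open>diag\<close> removes the entry of
  \<open>w\<close> that the matrix overwrites.\<close>

lemma graph_laplacian_bilinear:
  assumes diag: "\<And>v. v < n \<Longrightarrow> w v v = 0" and x: "x \<in> carrier_vec n" and y: "y \<in> carrier_vec n"
  shows "y \<bullet> (graph_laplacian n w *\<^sub>v x) = (\<Sum>v<n. \<Sum>u<n. w v u * (y $ v * (x $ u - x $ v)))"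
proof -
  have "(graph_laplacian n w *\<^sub>v x) $ v = (\<Sum>u<n. w v u * (x $ u - x $ v))" if v: "v < n" for v
  proof -
    have "(graph_laplacian n w *\<^sub>v x) $ v
        = (\<Sum>u<n. (if v = u then - (\<Sum>u'<n. w v u') else w v u) * x $ u)"
      using x v by (simp add: graph_laplacian_def scalar_prod_def atLeast0LessThan)
    also have "\<dots> = (\<Sum>u<n. w v u * x $ u - (if u = v then (\<Sum>u'<n. w v u') * x $ v else 0))"
      using diag[OF v] by (intro sum.cong) auto
    also have "\<dots> = (\<Sum>u<n. w v u * (x $ u - x $ v))"
      using v by (simp add: sum_subtractf sum_distrib_right right_diff_distrib)
    finally show ?thesis .
  qed
  then show ?thesis
    using y by (simp add: scalar_prod_def graph_laplacian_def atLeast0LessThan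
        sum_distrib_left mult_ac)
qed

lemma ring_edge_distinct:
  fixes N i :: nat
  assumes "N \<ge> 3"
  shows "i mod N \<noteq> (i + 1) mod N"
  using assms by (auto simp: mod_Suc)

text \<open>Double counting: after the sums are swapped, each edge is met by exactly two ordered
  pairs, its two orientations, since its endpoints differ.\<close>

lemma sum_ring_weight:
  assumes N: "N \<ge> 3"
  shows "(\<Sum>v<N. \<Sum>u<N. ring_weight N \<gamma> v u * f v u)
       = (\<Sum>i=1..N. \<gamma> i * (f (i mod N) ((i + 1) mod N) + f ((i + 1) mod N) (i mod N)))"
proof -
  have "(\<Sum>v<N. \<Sum>u<N. ring_weight N \<gamma> v u * f v u)
      = (\<Sum>(v, u)\<in>{..<N}\<times>{..<N}. \<Sum>i=1..N.
          if {v, u} = {i mod N, (i + 1) mod N} then \<gamma> i * f v u else 0)"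
    unfolding sum.cartesian_product ring_weight_def
    by (intro sum.cong refl) (auto simp: sum_distrib_right sum.inter_filter[symmetric])
  also have "\<dots> = (\<Sum>i=1..N. \<Sum>(v, u)\<in>{..<N}\<times>{..<N}.
          if {v, u} = {i mod N, (i + 1) mod N} then \<gamma> i * f v u else 0)"
    unfolding case_prod_unfold by (rule sum.swap)
  also have "\<dots> = (\<Sum>i=1..N. \<gamma> i * (f (i mod N) ((i + 1) mod N) + f ((i + 1) mod N) (i mod N)))"
  proof (intro sum.cong refl)
    fix i
    let ?a = "i mod N" and ?b = "(i + 1) mod N"
    have ab: "?a \<noteq> ?b" "?a < N" "?b < N" using ring_edge_distinct[OF N] N by auto
    have "(\<Sum>(v, u)\<in>{..<N}\<times>{..<N}. if {v, u} = {?a, ?b} then \<gamma> i * f v u else 0)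
        = (\<Sum>(v, u)\<in>{(?a, ?b), (?b, ?a)}. \<gamma> i * f v u)"
      by (rule sum.mono_neutral_cong_right)
        (use ab in \<open>auto simp: doubleton_eq_iff split: if_splits\<close>)
    also have "\<dots> = \<gamma> i * (f ?a ?b + f ?b ?a)"
      using ab by (simp add: distrib_left)
    finally show "(\<Sum>(v, u)\<in>{..<N}\<times>{..<N}. if {v, u} = {?a, ?b} then \<gamma> i * f v u else 0)
        = \<gamma> i * (f ?a ?b + f ?b ?a)" .
  qed
  finally show ?thesis .
qed

lemma ring_laplacian_carrier [simp]: "ring_laplacian N \<gamma> \<in> carrier_mat N N"
  by (simp add: ring_laplacian_def graph_laplacian_def)

lemma ring_laplacian_symmetric: "transpose_mat (ring_laplacian N \<gamma>) = ring_laplacian N \<gamma>"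
  by (rule eq_matI)
    (auto simp: ring_laplacian_def graph_laplacian_def ring_weight_def insert_commute)

text \<open>The two orientations of an edge \<open>a\<close>, \<open>b\<close> contribute
  \<open>y a * (x b - x a) + y b * (x a - x b)\<close>, which is minus the product of the
  differences of \<open>y\<close> and \<open>x\<close>.\<close>

lemma ring_laplacian_bilinear:
  assumes N: "N \<ge> 3" and x: "x \<in> carrier_vec N" and y: "y \<in> carrier_vec N"
  shows "y \<bullet> (ring_laplacian N \<gamma> *\<^sub>v x)
    = - (\<Sum>i=1..N. \<gamma> i * ring_diff N (($) y) i * ring_diff N (($) x) i)"
proof -
  have "ring_weight N \<gamma> v v = 0" for v
    unfolding ring_weight_def
  proof (rule sum.neutral, rule ballI)
    fix i assume "i \<in> {i \<in> {1..N}. {v, v} = {i mod N, (i + 1) mod N}}"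
    then have "{v, v} = {i mod N, (i + 1) mod N}" by blast
    then have "i mod N = (i + 1) mod N" unfolding doubleton_eq_iff by auto
    then show "\<gamma> i = 0" using ring_edge_distinct[OF N] by blast
  qed
  then have "y \<bullet> (ring_laplacian N \<gamma> *\<^sub>v x)
      = (\<Sum>v<N. \<Sum>u<N. ring_weight N \<gamma> v u * (y $ v * (x $ u - x $ v)))"
    unfolding ring_laplacian_def by (intro graph_laplacian_bilinear x y)
  also have "\<dots> = - (\<Sum>i=1..N. \<gamma> i * ring_diff N (($) y) i * ring_diff N (($) x) i)"
    unfolding sum_ring_weight[OF N] sum_negf[symmetric]
    by (intro sum.cong refl) (simp add: algebra_simps)
  finally show ?thesis .
qed

lemma sum_ring_diff:
  assumes "N \<ge> 3"
  shows "(\<Sum>i=1..N. ring_diff N x i) = 0"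
proof -
  have "(\<Sum>i=1..N. ring_diff N x i) = (\<Sum>i=1..N. (\<lambda>i. x (i mod N)) (Suc i) - (\<lambda>i. x (i mod N)) i)"
    by simp
  also have "\<dots> = x (Suc N mod N) - x (1 mod N)"
    using assms by (subst sum_Suc_diff) auto
  \<comment> \<open>The telescoped sum closes up because \<open>N + 1\<close> and 1 denote the same
    vertex.\<close>
  also have "\<dots> = 0" using assms by (simp add: mod_Suc)
  finally show ?thesis .
qed

lemma sum_atLeast1_split:
  fixes f :: "nat \<Rightarrow> real"
  assumes "1 \<le> N"
  shows "(\<Sum>i=1..N. f i) = f 1 + (\<Sum>i=2..N. f i)"
  using sum.atLeast_Suc_atMost[of 1 N f] assms by (simp add: numeral_2_eq_2)

text \<open>A constant flow is a circulation. Paired with a unit vector, the Laplacian gives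
  \<open>- c\<close> times the differences of that vector, which sum to 0 around the ring.\<close>

lemma ring_laplacian_eq_0I:
  assumes N: "N \<ge> 3" and x: "x \<in> carrier_vec N"
    and flow: "\<And>i. i \<in> {1..N} \<Longrightarrow> \<gamma> i * ring_diff N (($) x) i = c"
  shows "ring_laplacian N \<gamma> *\<^sub>v x = 0\<^sub>v N"
proof (rule eq_vecI)
  fix v assume "v < dim_vec (0\<^sub>v N)"
  then have v: "v < N" by simp
  let ?L = "ring_laplacian N \<gamma>"
  have "(?L *\<^sub>v x) $ v = unit_vec N v \<bullet> (?L *\<^sub>v x)"
    using v x mult_mat_vec_carrier[OF ring_laplacian_carrier x]
    by (subst scalar_prod_left_unit[of _ N]) auto
  also have "\<dots> = - (\<Sum>i=1..N. \<gamma> i * ring_diff N (($) (unit_vec N v)) i * ring_diff N (($) x) i)"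
    by (rule ring_laplacian_bilinear[OF N x]) simp
  also have "\<dots> = - (\<Sum>i=1..N. c * ring_diff N (($) (unit_vec N v)) i)"
    by (intro arg_cong[where f = uminus] sum.cong refl) (use flow in \<open>simp add: mult_ac\<close>)
  also have "\<dots> = 0"
    using sum_ring_diff[OF N] by (simp only: sum_distrib_left[symmetric])
  finally show "(?L *\<^sub>v x) $ v = 0\<^sub>v N $ v" using v by simp
qed (simp add: carrier_matD[OF ring_laplacian_carrier])

text \<open>Weighted Cauchy-Schwarz, from the nonnegative polynomial in \<open>t\<close> that sums
  \<open>(1 + t * (g i * d i))^2 / g i\<close>.\<close>

lemma sum_square_le_weighted:
  fixes d g :: "'a \<Rightarrow> real"
  assumes pos: "\<And>i. i \<in> I \<Longrightarrow> 0 < g i"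
  shows "(\<Sum>i\<in>I. d i)\<^sup>2 \<le> (\<Sum>i\<in>I. 1 / g i) * (\<Sum>i\<in>I. g i * (d i)\<^sup>2)"
proof -
  \<comment> \<open>All signs are flipped to fit the discriminant lemma, which is about nonpositive
    polynomials.\<close>
  have "(- (\<Sum>i\<in>I. d i))\<^sup>2 \<le> (- (\<Sum>i\<in>I. 1 / g i)) * (- (\<Sum>i\<in>I. g i * (d i)\<^sup>2))"
  proof (rule nonpos_quadratic_discriminant)
    show "- (\<Sum>i\<in>I. g i * (d i)\<^sup>2) \<le> 0"
      using pos by (simp add: sum_nonneg less_imp_le)
    fix t :: real
    have "0 \<le> (\<Sum>i\<in>I. (1 + t * (g i * d i))\<^sup>2 / g i)"
      using pos by (intro sum_nonneg) (simp add: less_imp_le)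
    also have "\<dots> = (\<Sum>i\<in>I. 1 / g i + 2 * t * d i + t\<^sup>2 * (g i * (d i)\<^sup>2))"
      by (intro sum.cong refl) (use pos in \<open>force simp: field_simps power2_eq_square\<close>)
    finally show "- (\<Sum>i\<in>I. 1 / g i) + 2 * t * - (\<Sum>i\<in>I. d i)
        + t\<^sup>2 * - (\<Sum>i\<in>I. g i * (d i)\<^sup>2) \<le> 0"
      by (simp add: sum.distrib sum_distrib_left)
  qed
  then show ?thesis by simp
qed

section \<open>Rings with exactly one negative edge\<close>

context
  fixes N :: nat and \<gamma> :: "nat \<Rightarrow> real"
  assumes N: "N \<ge> 3"
    and neg: "\<gamma> 1 < 0"
    and pos: "\<And>i. i \<in> {2..N} \<Longrightarrow> \<gamma> i > 0"
begin

lemma sum_inverse_positive_weights: "0 < (\<Sum>i=2..N. 1 / \<gamma> i)"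
  using N pos by (intro sum_pos) auto

lemma sum_inverse_weights_split: "(\<Sum>i=1..N. 1 / \<gamma> i) = 1 / \<gamma> 1 + (\<Sum>i=2..N. 1 / \<gamma> i)"
  using N by (intro sum_atLeast1_split) simp

text \<open>Multiplying \<open>1 / \<gamma> 1 + S < 0\<close> by the negative
  \<open>\<gamma> 1\<close> reverses it; dividing by the positive sum \<open>S\<close> over the
  other edges then isolates \<open>\<gamma> 1\<close>.\<close>

lemma ring_condition_iff:
  "(\<Sum>i=1..N. 1 / \<gamma> i) < 0 \<longleftrightarrow> \<gamma> 1 > - 1 / (\<Sum>i=2..N. 1 / \<gamma> i)"
  unfolding sum_inverse_weights_split
  using neg sum_inverse_positive_weights by (simp add: field_simps) linarith

lemma ring_form_eq:
  assumes x: "x \<in> carrier_vec N"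
  shows "x \<bullet> (ring_laplacian N \<gamma> *\<^sub>v x)
    = - \<gamma> 1 * (ring_diff N (($) x) 1)\<^sup>2 - (\<Sum>i=2..N. \<gamma> i * (ring_diff N (($) x) i)\<^sup>2)"
  using N x by (simp only: ring_laplacian_bilinear[OF N x x] sum_atLeast1_split)
    (simp add: power2_eq_square mult.assoc)

text \<open>The potential whose flow \<open>\<gamma> i * ring_diff\<close> is 1 on every positive edge; vertices 0 and 1 are
  the endpoints \<open>N\<close> and \<open>N + 1\<close> of the path formed by these edges.\<close>

definition ring_potential :: "real vec" where
  "ring_potential = vec N (\<lambda>v. \<Sum>j=2..<if v < 2 then N + v else v. 1 / \<gamma> j)"

lemma ring_potential_carrier [simp]: "ring_potential \<in> carrier_vec N"
  by (simp add: ring_potential_def)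

lemma ring_diff_potential:
  assumes "i \<in> {2..N}"
  shows "ring_diff N (($) ring_potential) i = 1 / \<gamma> i"
proof -
  \<comment> \<open>Edges \<open>N - 1\<close> and \<open>N\<close> end at vertices 0 and 1, where
    the potential uses the path positions \<open>N\<close> and \<open>N + 1\<close>.\<close>
  consider "i + 1 < N" | "i + 1 = N" | "i = N" using assms by force
  then show ?thesis
    using assms N by cases (auto simp: ring_potential_def mod_Suc)
qed

text \<open>Vertex 2 starts the positive path with potential 0, and vertex 1 ends it with the full
  sum.\<close>

lemma ring_diff_potential_negative_edge:
  "ring_diff N (($) ring_potential) 1 = - (\<Sum>i=2..N. 1 / \<gamma> i)"
  using N by (simp add: ring_potential_def atLeastLessThanSuc_atLeastAtMost)

text \<open>The first two factors have a positive product, so the form at this vector has the sign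
  of the sum over all edges.\<close>

lemma ring_potential_form:
  "ring_potential \<bullet> (ring_laplacian N \<gamma> *\<^sub>v ring_potential)
    = - \<gamma> 1 * (\<Sum>i=2..N. 1 / \<gamma> i) * (\<Sum>i=1..N. 1 / \<gamma> i)"
proof -
  let ?S = "\<Sum>i=2..N. 1 / \<gamma> i"
  have "(\<Sum>i=2..N. \<gamma> i * (ring_diff N (($) ring_potential) i)\<^sup>2) = ?S"
    by (intro sum.cong refl)
      (use pos ring_diff_potential in \<open>force simp: power2_eq_square\<close>)
  then have "ring_potential \<bullet> (ring_laplacian N \<gamma> *\<^sub>v ring_potential) = - \<gamma> 1 * ?S\<^sup>2 - ?S"
    unfolding ring_form_eq[OF ring_potential_carrier] ring_diff_potential_negative_edge by simp
  also have "\<dots> = - \<gamma> 1 * ?S * (1 / \<gamma> 1 + ?S)"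
    using neg by (simp add: field_simps power2_eq_square)
  finally show ?thesis unfolding sum_inverse_weights_split .
qed

lemma unstable_ring_laplacian:
  assumes "0 < (\<Sum>i=1..N. 1 / \<gamma> i)"
  shows "\<not> stable_mat (ring_laplacian N \<gamma>)"
proof -
  have "0 < ring_potential \<bullet> (ring_laplacian N \<gamma> *\<^sub>v ring_potential)"
    unfolding ring_potential_form
    using neg sum_inverse_positive_weights assms by (intro mult_pos_pos) auto
  then show ?thesis
    using symmetric_positive_eigenvalueI[OF ring_laplacian_carrier ring_laplacian_symmetric
        ring_potential_carrier] by (simp add: stable_mat_def)
qed

text \<open>The difference across edge 1 is minus the sum of the others, so Cauchy-Schwarz bounds
  its square by the positive energy. The factor
  \<open>\<gamma> 1 * (\<Sum>i=1..N. 1 / \<gamma> i)\<close> is nonnegative when the sum is at most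
  0, and positive when the sum is negative; these cases give stability and the kernel
  respectively.\<close>

lemma ring_form_upper_bound:
  assumes x: "x \<in> carrier_vec N"
  shows "x \<bullet> (ring_laplacian N \<gamma> *\<^sub>v x)
    \<le> \<gamma> 1 * (\<Sum>i=1..N. 1 / \<gamma> i) * - (\<Sum>i=2..N. \<gamma> i * (ring_diff N (($) x) i)\<^sup>2)"
proof -
  let ?S = "\<Sum>i=2..N. 1 / \<gamma> i" and ?D = "\<Sum>i=2..N. \<gamma> i * (ring_diff N (($) x) i)\<^sup>2"
  have "ring_diff N (($) x) 1 = - (\<Sum>i=2..N. ring_diff N (($) x) i)"
    using sum_ring_diff[OF N, of "($) x"] sum_atLeast1_split[of N "ring_diff N (($) x)"] N by simp
  then have "(ring_diff N (($) x) 1)\<^sup>2 \<le> ?S * ?D"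
    using sum_square_le_weighted[of "{2..N}" \<gamma> "ring_diff N (($) x)"] pos by simp
  then have "- \<gamma> 1 * (ring_diff N (($) x) 1)\<^sup>2 \<le> - \<gamma> 1 * (?S * ?D)"
    using neg by (intro mult_left_mono) auto
  then have "x \<bullet> (ring_laplacian N \<gamma> *\<^sub>v x) \<le> - \<gamma> 1 * (?S * ?D) - ?D"
    unfolding ring_form_eq[OF x] by simp
  also have "\<dots> = \<gamma> 1 * (1 / \<gamma> 1 + ?S) * - ?D"
    using neg by (simp add: field_simps)
  finally show ?thesis unfolding sum_inverse_weights_split .
qed

lemma ring_positive_energy_nonneg: "0 \<le> (\<Sum>i=2..N. \<gamma> i * (ring_diff N x i)\<^sup>2)"
  using pos by (intro sum_nonneg) (simp add: less_imp_le)

lemma stable_ring_laplacian: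
  assumes S: "(\<Sum>i=1..N. 1 / \<gamma> i) \<le> 0"
  shows "stable_mat (ring_laplacian N \<gamma>)"
  unfolding stable_mat_def
proof
  assume "\<exists>k. eigenvalue (ring_laplacian N \<gamma>) k \<and> k > 0"
  then obtain k x where k: "k > 0" and x: "x \<in> carrier_vec N" "x \<noteq> 0\<^sub>v N"
    and ev: "ring_laplacian N \<gamma> *\<^sub>v x = k \<cdot>\<^sub>v x"
    by (auto simp: eigenvalue_def eigenvector_def carrier_matD[OF ring_laplacian_carrier])
  have "0 < k * (x \<bullet> x)" using k scalar_prod_self_pos[OF x] by simp
  also have "\<dots> = x \<bullet> (ring_laplacian N \<gamma> *\<^sub>v x)" using x ev by simp
  also have "\<dots> \<le> \<gamma> 1 * (\<Sum>i=1..N. 1 / \<gamma> i) * - (\<Sum>i=2..N. \<gamma> i * (ring_diff N (($) x) i)\<^sup>2)"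
    by (rule ring_form_upper_bound[OF x(1)])
  also have "\<dots> \<le> 0"
    using neg S ring_positive_energy_nonneg[of "($) x"]
    by (intro mult_nonneg_nonpos mult_nonpos_nonpos) auto
  finally show False by simp
qed

section \<open>The kernel of the ring Laplacian\<close>

lemma const_in_ring_kernel: "vec N (\<lambda>_. c) \<in> mat_kernel (ring_laplacian N \<gamma>)"
  by (rule mat_kernelI[OF ring_laplacian_carrier], simp, rule ring_laplacian_eq_0I[where c = 0])
    (use N in auto)

text \<open>The positive edges alone already form a path through all vertices.\<close>

lemma const_of_ring_diff_eq_0:
  assumes x: "x \<in> carrier_vec N" and "\<And>i. i \<in> {2..N} \<Longrightarrow> ring_diff N (($) x) i = 0"
  shows "x = vec N (\<lambda>_. x $ 0)"
proof -
  \<comment> \<open>The induction follows the path from vertex 2 up to \<open>Suc N\<close>, so that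
    the last two positions reach vertices 0 and 1.\<close>
  have const: "x $ (i mod N) = x $ (2 mod N)" if "2 \<le> i" "i \<le> Suc N" for i
    using that
  proof (induction i rule: dec_induct)
    case (step i)
    then show ?case using assms(2)[of i] by simp
  qed simp
  have all: "x $ v = x $ 0" if "v < N" for v
  proof -
    have "x $ v = x $ (2 mod N)"
    proof (cases "v < 2")
      case True
      then have "x $ ((N + v) mod N) = x $ (2 mod N)" using N by (intro const) auto
      then show ?thesis using that by simp
    next
      case False
      then have "x $ (v mod N) = x $ (2 mod N)" using that by (intro const) auto
      then show ?thesis using that by simp
    qed
    also have "\<dots> = x $ 0" using const[of N] N by simp
    finally show ?thesis .
  qed
  show ?thesis
  proof (rule eq_vecI)
    fix v assume "v < dim_vec (vec N (\<lambda>_. x $ 0))"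
    then have "v < N" by simp
    then show "x $ v = vec N (\<lambda>_. x $ 0) $ v" using all[of v] by simp
  qed (use x in simp)
qed

text \<open>The form vanishes on the kernel, so the upper bound with its positive factor forces the
  energy of the positive edges, and hence each of its terms, to be 0.\<close>

lemma ring_kernel_const:
  assumes S: "(\<Sum>i=1..N. 1 / \<gamma> i) < 0" and x: "x \<in> mat_kernel (ring_laplacian N \<gamma>)"
  shows "x = vec N (\<lambda>_. x $ 0)"
proof (rule const_of_ring_diff_eq_0)
  note xc = mat_kernelD[OF ring_laplacian_carrier x]
  then show "x \<in> carrier_vec N" by simp
  let ?D = "\<Sum>i=2..N. \<gamma> i * (ring_diff N (($) x) i)\<^sup>2"
  have "0 \<le> \<gamma> 1 * (\<Sum>i=1..N. 1 / \<gamma> i) * - ?D"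
    using ring_form_upper_bound[OF xc(1)] xc by simp
  moreover have "0 < \<gamma> 1 * (\<Sum>i=1..N. 1 / \<gamma> i)" using neg S by (rule mult_neg_neg)
  ultimately have "0 \<le> - ?D" unfolding zero_le_mult_iff by linarith
  then have "?D = 0" using ring_positive_energy_nonneg[of "($) x"] by linarith
  then show "ring_diff N (($) x) i = 0" if "i \<in> {2..N}" for i
    using that pos by (subst (asm) sum_nonneg_eq_0_iff) (force simp: less_imp_le)+
qed

text \<open>At zero sum the difference across edge 1 is \<open>1 / \<gamma> 1\<close>, so the unit
  flow continues through the negative edge and becomes a circulation.\<close>

lemma ring_potential_in_kernel:
  assumes S: "(\<Sum>i=1..N. 1 / \<gamma> i) = 0"
  shows "ring_potential \<in> mat_kernel (ring_laplacian N \<gamma>)"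
proof (rule mat_kernelI[OF ring_laplacian_carrier ring_potential_carrier],
    rule ring_laplacian_eq_0I[OF N ring_potential_carrier])
  fix i assume i: "i \<in> {1..N}"
  show "\<gamma> i * ring_diff N (($) ring_potential) i = 1"
  proof (cases "i = 1")
    case True
    have "- (\<Sum>i=2..N. 1 / \<gamma> i) = 1 / \<gamma> 1" using S unfolding sum_inverse_weights_split by simp
    then show ?thesis using True neg ring_diff_potential_negative_edge by simp
  next
    case False
    with i have "i \<in> {2..N}" by auto
    then show ?thesis using ring_diff_potential pos[of i] by simp
  qed
qed

lemma kernel_dim_ring_laplacian_eq_1:
  assumes S: "(\<Sum>i=1..N. 1 / \<gamma> i) < 0"
  shows "kernel_dim (ring_laplacian N \<gamma>) = 1"
  unfolding kernel_dim_eq_1_iff[OF ring_laplacian_carrier]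
proof (intro bexI conjI ballI)
  let ?one = "vec N (\<lambda>_. 1 :: real)"
  show "?one \<in> mat_kernel (ring_laplacian N \<gamma>)" by (rule const_in_ring_kernel)
  have "?one $ 0 \<noteq> 0\<^sub>v N $ 0" using N by simp
  then show "?one \<noteq> 0\<^sub>v N" by metis
  fix x assume "x \<in> mat_kernel (ring_laplacian N \<gamma>)"
  from ring_kernel_const[OF S this] have x: "x = vec N (\<lambda>_. x $ 0)" .
  have "x = x $ 0 \<cdot>\<^sub>v ?one" by (subst x, rule eq_vecI) auto
  then show "\<exists>c. x = c \<cdot>\<^sub>v ?one" by blast
qed

lemma kernel_dim_ring_laplacian_neq_1:
  assumes S: "(\<Sum>i=1..N. 1 / \<gamma> i) = 0"
  shows "kernel_dim (ring_laplacian N \<gamma>) \<noteq> 1"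
proof
  assume "kernel_dim (ring_laplacian N \<gamma>) = 1"
  then obtain v where v: "\<forall>u\<in>mat_kernel (ring_laplacian N \<gamma>). \<exists>c. u = c \<cdot>\<^sub>v v"
    and vc: "v \<in> mat_kernel (ring_laplacian N \<gamma>)"
    unfolding kernel_dim_eq_1_iff[OF ring_laplacian_carrier] by blast
  have dim: "v \<in> carrier_vec N" using vc by (rule mat_kernelD[OF ring_laplacian_carrier])
  from v obtain a where a: "vec N (\<lambda>_. 1) = a \<cdot>\<^sub>v v" using const_in_ring_kernel by blast
  from v obtain b where b: "ring_potential = b \<cdot>\<^sub>v v" using ring_potential_in_kernel[OF S] by blast
  have av: "a * v $ i = 1" if "i < N" for i
    using arg_cong[OF a, of "\<lambda>x. x $ i"] dim that by simp
  \<comment> \<open>Vertices 1 and 2 are the ends of the negative edge. A multiple of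
    \<open>v\<close> is constant, hence so is \<open>v\<close>, yet \<open>ring_potential\<close>
    differs at these two vertices.\<close>
  have "a \<noteq> 0" "a * v $ 1 = a * v $ 2" using av[of 1] av[of 2] N by auto
  then have "v $ 1 = v $ 2" by simp
  then have "ring_potential $ 1 = ring_potential $ 2" using b dim N by simp
  moreover have "1 mod N = 1" "(1 + 1) mod N = 2" using N by auto
  ultimately have "ring_diff N (($) ring_potential) 1 = 0" by simp
  then show False
    using ring_diff_potential_negative_edge sum_inverse_positive_weights by simp
qed

lemma stable_ring_laplacian_iff:
  "stable_mat (ring_laplacian N \<gamma>) \<longleftrightarrow> (\<Sum>i=1..N. 1 / \<gamma> i) \<le> 0"
  using stable_ring_laplacian unstable_ring_laplacian by (meson not_le)

text \<open>The kernel condition removes exactly the boundary case of zero sum from the range of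
  stability.\<close>

lemma strictly_stable_ring_laplacian_iff:
  "strictly_stable_mat (ring_laplacian N \<gamma>) \<longleftrightarrow> (\<Sum>i=1..N. 1 / \<gamma> i) < 0"
  unfolding strictly_stable_mat_def stable_ring_laplacian_iff
  using kernel_dim_ring_laplacian_eq_1 kernel_dim_ring_laplacian_neq_1 by (auto simp: le_less)

lemma ring_condition_equal_weights:
  assumes "\<forall>i\<in>{2..N}. \<gamma> i = g"
  shows "1 / (\<Sum>i=2..N. 1 / \<gamma> i) = g / (real N - 1)"
proof -
  have "(\<Sum>i=2..N. 1 / \<gamma> i) = (\<Sum>i=2..N. 1 / g)" using assms by (intro sum.cong) auto
  also have "\<dots> = (real N - 1) / g" using N by (simp add: of_nat_diff)
  finally show ?thesis by simp
qed

lemma sum_inverse_weights_eq_0_iff: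
  "(\<Sum>i=1..N. 1 / \<gamma> i) = 0 \<longleftrightarrow> \<gamma> 1 = - 1 / (\<Sum>i=2..N. 1 / \<gamma> i)"
  unfolding sum_inverse_weights_split
  using neg sum_inverse_positive_weights by (auto simp: field_simps)

end

text \<open>At zero sum the Laplacian is still stable, with a larger kernel. The strict inequality
  therefore characterizes \<open>stable_mat\<close> away from this boundary, and
  \<open>strictly_stable_mat\<close> without exception.\<close>

theorem mainTheorem3:
  fixes N :: nat and \<gamma> :: "nat \<Rightarrow> real"
  assumes "N \<ge> 3"
    and "\<gamma> 1 < 0"
    and "\<And>i. i \<in> {2..N} \<Longrightarrow> \<gamma> i > 0"
  shows
    "((\<Sum>i=1..N. 1 / \<gamma> i) < 0 \<longleftrightarrow> \<gamma> 1 > - 1 / (\<Sum>i=2..N. 1 / \<gamma> i))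
   \<and> ((\<Sum>i=1..N. 1 / \<gamma> i) \<noteq> 0 \<longrightarrow>
        (stable_mat (ring_laplacian N \<gamma>) \<longleftrightarrow> (\<Sum>i=1..N. 1 / \<gamma> i) < 0)
      \<and> (stable_mat (ring_laplacian N \<gamma>) \<longleftrightarrow> \<gamma> 1 > - 1 / (\<Sum>i=2..N. 1 / \<gamma> i)))
   \<and> ((\<Sum>i=1..N. 1 / \<gamma> i) = 0 \<longrightarrow> stable_mat (ring_laplacian N \<gamma>))
   \<and> (strictly_stable_mat (ring_laplacian N \<gamma>) \<longleftrightarrow> (\<Sum>i=1..N. 1 / \<gamma> i) < 0)
   \<and> (strictly_stable_mat (ring_laplacian N \<gamma>) \<longleftrightarrow> \<gamma> 1 > - 1 / (\<Sum>i=2..N. 1 / \<gamma> i))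
   \<and> (\<forall>g. (\<forall>i\<in>{2..N}. \<gamma> i = g) \<longrightarrow>
        (\<gamma> 1 > - 1 / (\<Sum>i=2..N. 1 / \<gamma> i) \<longleftrightarrow> \<gamma> 1 > - g / (real N - 1))
      \<and> (\<gamma> 1 \<noteq> - g / (real N - 1) \<longrightarrow>
           (stable_mat (ring_laplacian N \<gamma>) \<longleftrightarrow> \<gamma> 1 > - g / (real N - 1)))
      \<and> (strictly_stable_mat (ring_laplacian N \<gamma>) \<longleftrightarrow> \<gamma> 1 > - g / (real N - 1)))"
proof -
  have g: "- 1 / (\<Sum>i=2..N. 1 / \<gamma> i) = - g / (real N - 1)" if "\<forall>i\<in>{2..N}. \<gamma> i = g" for g
    using ring_condition_equal_weights[of N \<gamma>, OF assms that] by simp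
  have cond: "(\<Sum>i=1..N. 1 / \<gamma> i) < 0 \<longleftrightarrow> \<gamma> 1 > - 1 / (\<Sum>i=2..N. 1 / \<gamma> i)"
    using assms by (rule ring_condition_iff)
  have zero: "(\<Sum>i=1..N. 1 / \<gamma> i) = 0 \<longleftrightarrow> \<gamma> 1 = - 1 / (\<Sum>i=2..N. 1 / \<gamma> i)"
    using assms by (rule sum_inverse_weights_eq_0_iff)
  have stable: "stable_mat (ring_laplacian N \<gamma>) \<longleftrightarrow> (\<Sum>i=1..N. 1 / \<gamma> i) \<le> 0"
    using assms by (rule stable_ring_laplacian_iff)
  have strict: "strictly_stable_mat (ring_laplacian N \<gamma>) \<longleftrightarrow> (\<Sum>i=1..N. 1 / \<gamma> i) < 0"
    using assms by (rule strictly_stable_ring_laplacian_iff)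
  have stable': "stable_mat (ring_laplacian N \<gamma>) \<longleftrightarrow> (\<Sum>i=1..N. 1 / \<gamma> i) < 0"
    if "(\<Sum>i=1..N. 1 / \<gamma> i) \<noteq> 0"
    using that stable by (auto simp: le_less)
  show ?thesis
  proof (intro conjI impI allI)
    fix g assume eq: "\<forall>i\<in>{2..N}. \<gamma> i = g"
    show "strictly_stable_mat (ring_laplacian N \<gamma>) \<longleftrightarrow> \<gamma> 1 > - g / (real N - 1)"
      by (simp only: strict cond g[OF eq])
    show "stable_mat (ring_laplacian N \<gamma>) \<longleftrightarrow> \<gamma> 1 > - g / (real N - 1)"
      if "\<gamma> 1 \<noteq> - g / (real N - 1)"
    proof -
      have "(\<Sum>i=1..N. 1 / \<gamma> i) \<noteq> 0" using that by (simp only: zero g[OF eq] not_False_eq_True)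
      from stable'[OF this] show ?thesis by (simp only: cond g[OF eq])
    qed
    show "\<gamma> 1 > - 1 / (\<Sum>i=2..N. 1 / \<gamma> i) \<longleftrightarrow> \<gamma> 1 > - g / (real N - 1)"
      by (simp only: g[OF eq])
  next
    assume S: "(\<Sum>i=1..N. 1 / \<gamma> i) \<noteq> 0"
    show "stable_mat (ring_laplacian N \<gamma>) \<longleftrightarrow> (\<Sum>i=1..N. 1 / \<gamma> i) < 0"
      by (rule stable'[OF S])
    show "stable_mat (ring_laplacian N \<gamma>) \<longleftrightarrow> \<gamma> 1 > - 1 / (\<Sum>i=2..N. 1 / \<gamma> i)"
      by (simp only: stable'[OF S] cond)
  next
    assume "(\<Sum>i=1..N. 1 / \<gamma> i) = 0"
    then show "stable_mat (ring_laplacian N \<gamma>)" unfolding stable by simp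
  next
    show "strictly_stable_mat (ring_laplacian N \<gamma>) \<longleftrightarrow> \<gamma> 1 > - 1 / (\<Sum>i=2..N. 1 / \<gamma> i)"
      by (simp only: strict cond)
  qed (rule cond strict)+
qed

end
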